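(* Let $\widetilde Q:\mathbb{Z}_{\ge1}\to\mathbb{Z}$ be defined by $\widetilde Q(1)=\widetilde Q(2)=1$ and, for $n\ge3$, \[ \widetilde Q(n)=\widetilde Q\bigl(n-\widetilde Q(n-1)\bigr)+\widetilde Q\bigl(n-\widetilde Q(n-2)\bigr)+(-1)^n . \] Then, as $n\to\infty$, \[ \left|\frac{\widetilde Q(n)}{n}-\frac12\right|=O\!\left(\frac{1}{\sqrt{\log n}}\right). \]
   Context: The recursion is well defined for every $n\ge1$: at each step the indices $n-\widetilde Q(n-1)$ and $n-\widetilde Q(n-2)$ lie in $\{1,\dots,n-1\}$. *)

theory Defs
  imports Complex_Main "HOL-Library.Landau_Symbols"
begin

text \<open>
  The perturbed Hofstadter sequence. The test on the indices \<open>i\<close> and \<open>j\<close> is there only to make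
  the nested recursion total in HOL: for this sequence both indices always lie in
  \<open>{1..n - 1}\<close>, so for \<open>n \<ge> 3\<close> the \<open>undefined\<close> branch is never taken. The argument \<open>0\<close> lies outside
  the domain of the sequence.
\<close>

function Qt :: "nat \<Rightarrow> int" where
  "Qt n =
    (if n = 0 then undefined
     else if n \<le> 2 then 1
     else let i = int n - Qt (n - 1);
              j = int n - Qt (n - 2)
          in if i \<in> {1..int n - 1} \<and> j \<in> {1..int n - 1}
             then Qt (nat i) + Qt (nat j) + (- 1) ^ n
             else undefined)"
  by pat_completeness auto
termination
  by (relation "measure (\<lambda>n. n)") auto

declare Qt.simps [simp del]

lemma Qt_1: "Qt 1 = 1"
  by (subst Qt.simps) simp

lemma Qt_2: "Qt 2 = 1"
  by (subst Qt.simps) simp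

lemma Qt_rec:
  assumes "n \<ge> 3"
    and "int n - Qt (n - 1) \<in> {1..int n - 1}"
    and "int n - Qt (n - 2) \<in> {1..int n - 1}"
  shows "Qt n = Qt (nat (int n - Qt (n - 1))) + Qt (nat (int n - Qt (n - 2))) + (- 1) ^ n"
  using assms by (subst Qt.simps) (simp add: Let_def)

end

theory Submission
  imports Defs
begin

text \<open>
  The integers split into generations with end points \<open>M j = \<lfloor>2\<^bsup>j+3\<^esup> / 3\<rfloor>\<close>. In generation \<open>j\<close> one
  has \<open>q n + q (n + 1) = n + j\<close> for all \<open>n\<close> of the parity of \<open>j\<close>, and the values \<open>q n\<close> at these
  \<open>n\<close> grow by \<open>0\<close> or \<open>2\<close>. For \<open>n\<close> in generation \<open>j + 1\<close> the recursion therefore reads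
  \<open>q (n + 2) = q P + q R \<plusminus> 1\<close> with \<open>P = q n - j + 1\<close> and \<open>R = n + 2 - q n\<close>: two pointers run through
  generation \<open>j\<close>, where \<open>P\<close> advances after an increment of \<open>2\<close> and \<open>R\<close> after an increment of \<open>0\<close>.
  So the last increment read by a resting pointer is \<open>0\<close> for \<open>P\<close> and \<open>2\<close> for \<open>R\<close>, and this
  carries the complement identity over to generation \<open>j + 1\<close>.

  Let \<open>\<delta> = q n - (n + j) / 2 - (-1)\<^sup>j / 3\<close> and \<open>r = n + j - 2\<^bsup>j+1\<^esup>\<close>. Both quantities are additive:
  \<open>\<delta>' = \<delta>\<^sub>P + \<delta>\<^sub>R\<close> and \<open>r' = r\<^sub>P + r\<^sub>R\<close>, while \<open>r\<^sub>P - r\<^sub>R = P - R = 2 \<delta>' + O(1)\<close>. The elliptic bound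
  \<open>j \<delta>\<^sup>2 \<le> 4\<^bsup>j+1\<^esup> - r\<^sup>2\<close> is then inherited by the next generation, because \<open>\<delta>'\<^sup>2 \<le> 2 (\<delta>\<^sub>P\<^sup>2 + \<delta>\<^sub>R\<^sup>2)\<close>
  and \<open>r\<^sub>P\<^sup>2 + r\<^sub>R\<^sup>2 = (r'\<^sup>2 + (P - R)\<^sup>2) / 2\<close>. It gives \<open>\<bar>\<delta>\<bar> \<le> 2\<^bsup>j+1\<^esup> / \<surd>j\<close>.
\<close>

section \<open>The recursion on integer indices\<close>

definition q :: "int \<Rightarrow> int" where
  "q n = Qt (nat n)"

text \<open>Depends on parity alone, so on indices of fixed parity within a generation the
  perturbation can be written in terms of \<open>J\<close>.\<close>

definition sgn_par :: "int \<Rightarrow> int" where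
  "sgn_par n = (if even n then 1 else - 1)"

lemma q_rec:
  assumes "n \<ge> 3"
    and "1 \<le> n - q (n - 1)" "n - q (n - 1) \<le> n - 1"
    and "1 \<le> n - q (n - 2)" "n - q (n - 2) \<le> n - 1"
  shows "q n = q (n - q (n - 1)) + q (n - q (n - 2)) + sgn_par n"
proof -
  obtain k where k: "n = int k" "k \<ge> 3"
    using assms(1) by (intro that[of "nat n"]) auto
  have 1: "nat (n - 1) = k - 1" "nat (n - 2) = k - 2" using k by auto
  have "Qt k = Qt (nat (int k - Qt (k - 1))) + Qt (nat (int k - Qt (k - 2))) + (- 1) ^ k"
    by (rule Qt_rec) (use assms k 1 in \<open>auto simp: q_def\<close>)
  moreover have "sgn_par n = (- 1) ^ k"
    by (simp add: sgn_par_def k)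
  ultimately show ?thesis using k 1 by (simp add: q_def)
qed

lemma q_recI:
  assumes "3 \<le> n" "q k = n - x" "q l = n - y" "k = n - 1" "l = n - 2"
    and "1 \<le> x" "x < n" "1 \<le> y" "y < n"
  shows "q n = q x + q y + sgn_par n"
  using q_rec[of n] assms by simp

lemma even_diff_obtains_nat:
  fixes m n :: int
  assumes "even (m - n)" "n \<le> m"
  obtains i :: nat where "m = n + 2 * int i"
proof -
  from assms(1) obtain k where "m - n = 2 * k" by (rule evenE)
  then show ?thesis using assms(2) by (intro that[of "nat k"]) auto
qed

lemma power2_sum_le: "(x + y)\<^sup>2 \<le> 2 * (x\<^sup>2 + y\<^sup>2)" for x y :: int
  using zero_le_power2[of "x - y"] by (simp add: power2_eq_square algebra_simps)

section \<open>Structure of one generation\<close>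

text \<open>
  \<open>gen J A B\<close> describes generation \<open>J\<close> with \<open>A = M (J - 1)\<close> and \<open>B = M J\<close>. It overlaps the
  preceding generation in the stretch on which \<open>q\<close> is constant (third clause).
\<close>

definition gen :: "int \<Rightarrow> int \<Rightarrow> int \<Rightarrow> bool" where
  "gen J A B \<longleftrightarrow>
     (\<forall>n. even (n - J) \<and> A - 2 * J + 3 \<le> n \<and> n \<le> B \<longrightarrow> q n + q (n + 1) = n + J \<and> odd (q n)) \<and>
     (\<forall>n. even (n - J) \<and> A - 2 * J + 3 \<le> n \<and> n + 2 \<le> B \<longrightarrow> q (n + 2) = q n \<or> q (n + 2) = q n + 2) \<and>
     (\<forall>n. even (n - J) \<and> A - 2 * J + 3 \<le> n \<and> n \<le> A - 1 \<longrightarrow> q (n + 2) = q n) \<and>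
     (\<forall>n. even (n - J) \<and> B - 2 * J \<le> n \<and> n \<le> B \<longrightarrow> q (n + 1) = B - A)"

lemma gen_sum: "gen J A B \<Longrightarrow> even (n - J) \<Longrightarrow> A - 2 * J + 3 \<le> n \<Longrightarrow> n \<le> B \<Longrightarrow> q (n + 1) = n + J - q n"
  unfolding gen_def by (elim conjE allE[of _ n]) simp

lemma gen_step:
  "gen J A B \<Longrightarrow> even (n - J) \<Longrightarrow> A - 2 * J + 3 \<le> n \<Longrightarrow> n + 2 \<le> B \<Longrightarrow> q (n + 2) = q n \<or> q (n + 2) = q n + 2"
  by (simp add: gen_def)

lemma gen_start:
  "gen J A B \<Longrightarrow> even (n - J) \<Longrightarrow> A - 2 * J + 3 \<le> n \<Longrightarrow> n \<le> A - 1 \<Longrightarrow> q (n + 2) = q n"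
  by (simp add: gen_def)

lemma gen_end:
  "gen J A B \<Longrightarrow> even (n - J) \<Longrightarrow> B - 2 * J \<le> n \<Longrightarrow> n \<le> B \<Longrightarrow> q (n + 1) = B - A"
  by (simp add: gen_def)

lemma gen_mono:
  assumes "gen J A B" "even (n - J)" "A - 2 * J + 3 \<le> n" "n \<le> m" "m \<le> B" "even (m - J)"
  shows "q n \<le> q m \<and> q m \<le> q n + (m - n)"
proof -
  have "q n \<le> q (n + 2 * int i) \<and> q (n + 2 * int i) \<le> q n + 2 * int i" if "n + 2 * int i \<le> B" for i
    using that
  proof (induction i)
    case (Suc i)
    have "q (n + 2 * int i + 2) = q (n + 2 * int i) \<or> q (n + 2 * int i + 2) = q (n + 2 * int i) + 2"
      by (rule gen_step[OF assms(1)]) (use assms Suc.prems in auto)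
    then show ?case using Suc by (auto simp: algebra_simps)
  qed auto
  moreover have "even (m - n)" using assms(2,6) by presburger
  then obtain i where "m = n + 2 * int i" using even_diff_obtains_nat assms(4) by blast
  ultimately show ?thesis using assms(5) by (metis add_diff_cancel_left')
qed

section \<open>Two pointers walking through a generation\<close>

text \<open>The pointers into generation \<open>J\<close> are \<open>P = q n - J + 1\<close> and \<open>R = n + 2 - q n\<close>.\<close>

definition walk :: "int \<Rightarrow> int \<Rightarrow> int \<Rightarrow> int \<Rightarrow> bool" where
  "walk J A B n \<longleftrightarrow>
     q n + q (n + 1) = n + J + 1 \<and> odd (q n) \<and>
     q (n + 2) = q (q n - J + 1) + q (n + 2 - q n) + sgn_par (J + 1) \<and>
     (q (n + 2) = q n \<and> q (q n - J + 1) = q (q n - J - 1) \<or>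
      q (n + 2) = q n + 2 \<and> q (n + 2 - q n) = q (n - q n) + 2) \<and>
     B - A \<le> q n \<and> q n - J + 1 \<le> B \<and> A + 1 \<le> n + 2 - q n \<and> n + 2 - q n \<le> B"

text \<open>This is \<open>6 \<delta>\<close>, which is an integer.\<close>

definition dev :: "int \<Rightarrow> int \<Rightarrow> int" where
  "dev J n = 6 * q n - 3 * (n + J) - 2 * sgn_par J"

text \<open>\<open>C\<close> is the end point of generation \<open>J + 1\<close>; \<open>b\<close>
  is the parity bit of \<open>J\<close> and carries the rounding in the doubling of end
  points.\<close>

locale generation =
  fixes J A B C b :: int
  assumes gen: "gen J A B" and J: "3 \<le> J" and A: "2 * J \<le> A" and b: "b = 0 \<or> b = 1"
    and parJ: "even (J - b)" and B: "B = 2 * A + b" and C: "C = 2 * B + 1 - b"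
    and parA: "odd (A - J)"
begin

lemma parB: "even (B - J)"
  using parJ B by auto

lemma sgn_J: "sgn_par J = 1 - 2 * b" "sgn_par (J + 1) = 2 * b - 1"
  using b parJ by (auto simp: sgn_par_def)

lemma J_b: "4 \<le> J + b"
  using J b parJ by (cases "J = 3") auto

text \<open>The walk begins with a flat step, since \<open>q\<close> is constant at the end of
  generation \<open>J\<close> on the parity of \<open>B - 1\<close>. Then
  \<open>P = A + b - J + 1\<close> lies in the constant opening stretch, which is where
  \<open>4 \<le> J + b\<close> enters, and \<open>R = A + 1\<close>.\<close>

lemma walk_start: "walk J A B (B - 1)"
proof -
  have c1: "q (B - 1) = B - A" "q (B + 1) = B - A" 
    using gen_end[OF gen, of "B - 2"] gen_end[OF gen, of "B"] parB J by auto
  have s: "q (B - 1) + q B = B + J"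
    using gen_sum[OF gen, of B] c1 parB J A b B by auto
  have o: "odd (B - A)" using parB parA by auto
  have oo: "q (B + 1) = q (B + 1 - q B) + q (B + 1 - q (B - 1)) + sgn_par (B + 1)"
    using q_rec[of "B + 1"] s c1 J A b B by auto
  have e: "sgn_par (B + 1) = sgn_par (J + 1)"
    using parB by (auto simp: sgn_par_def)
  have qB: "B + 1 - q B = q (B - 1) - J + 1" using s by simp
  have z: "q (q (B - 1) - J + 1) = q (q (B - 1) - J - 1)"
  proof -
    have "q (q (B - 1) - J - 1 + 2) = q (q (B - 1) - J - 1)"
      by (rule gen_start[OF gen]) (use o c1 J A b B J_b in auto)
    then show ?thesis by (simp add: algebra_simps)
  qed
  show ?thesis
    unfolding walk_def
    using s o oo e qB z c1 A B b J by (auto simp: algebra_simps)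
qed

text \<open>The recursion at \<open>n + 3\<close> reads \<open>q\<close> at \<open>P + 1\<close> and
  \<open>R' + 1\<close>. The complement identity of generation \<open>J\<close> turns these into
  \<open>q P\<close> and \<open>q R'\<close>, and the signs at \<open>n + 2\<close> and
  \<open>n + 3\<close> cancel. What remains is \<open>q R - q R'\<close>, which the invariant
  supplies.\<close>

lemma walk_sum:
  assumes w: "walk J A B n" and n: "B - 1 \<le> n" "even (n - J - 1)"
  shows "q (n + 2) + q (n + 3) = n + J + 3"
proof -
  note w' = w[unfolded walk_def]
  define P where "P = q n - J + 1"
  define R where "R = n + 2 - q n"
  define R' where "R' = n + 2 - q (n + 2)"
  have R': "R' = R \<or> R' = R - 2" using w' by (auto simp: R_def R'_def)
  have par: "even (P - J)" "even (R - J)" "even (R' - J)"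
    using w' n R' by (auto simp: P_def R_def)
  have cP: "q (P + 1) = P + J - q P"
    by (rule gen_sum[OF gen]) (use par w' J A B b in \<open>auto simp: P_def\<close>)
  have cR: "q (R' + 1) = R' + J - q R'"
    by (rule gen_sum[OF gen]) (use par w' R' J A B b in \<open>auto simp: R_def\<close>)
  have 1: "q (n + 2) = n + 3 - (R' + 1)" "q (n + 1) = n + 3 - (P + 1)"
    using w' by (auto simp: R'_def P_def)
  have rg: "2 \<le> P" "P \<le> B" "3 \<le> R" "R \<le> B"
    using w' J A B b by (auto simp: P_def R_def)
  have "q (n + 3) = q (R' + 1) + q (P + 1) + sgn_par (n + 3)"
    by (rule q_recI[OF _ 1]) (use rg R' n J A B b in auto)
  moreover have "sgn_par (n + 3) = - sgn_par (J + 1)"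
    using n by (auto simp: sgn_par_def)
  moreover have "q (n + 2) = q P + q R + sgn_par (J + 1)"
    using w' by (simp add: P_def R_def)
  moreover have "q (n + 2) = q n \<and> R' = R \<or> q (n + 2) = q n + 2 \<and> R' = R - 2 \<and> q R = q R' + 2"
    using w' by (auto simp: R_def R'_def algebra_simps)
  ultimately show ?thesis
    using cP cR by (auto simp: P_def R_def)
qed

text \<open>
  The recursion for \<open>q (n + 2)\<close> ties \<open>q R\<close> to \<open>q P - P\<close>, so \<open>R\<close> cannot reach the end of generation
  \<open>J\<close>, and the position of \<open>R\<close> is forced when \<open>P\<close> passes that end.
\<close>

lemma walk_balance:
  assumes w: "walk J A B n" and n: "B - 1 \<le> n" "even (n - J - 1)"
  shows "n + 2 - q n \<le> B - J + 2 - b"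
    and "q n - J + 1 = B \<Longrightarrow> q (n + 2) = q n + 2 \<Longrightarrow> n + 2 - q n = B - J + 2 - b"
proof -
  note w' = w[unfolded walk_def]
  define P where "P = q n - J + 1"
  define R where "R = n + 2 - q n"
  have par: "even (P - J)" "even (R - J)" using w' n by (auto simp: P_def R_def)
  have rg: "A - 2 * J + 3 \<le> P" "P \<le> B" "A - 2 * J + 3 \<le> R" "R \<le> B"
    using w' J A B b by (auto simp: P_def R_def)
  have eq: "q R + q P - P = q (n + 2) - q n + J - 2 * b"
    using w' sgn_J by (simp add: P_def R_def)
  have qe: "q m = m + J - (B - A)" if "even (m - J)" "B - 2 * J \<le> m" "m \<le> B" for m
    using gen_sum[OF gen, of m] gen_end[OF gen, of m] that J A B b by auto
  have comp: "P - q P \<le> B - q B"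
    using gen_mono[OF gen, of P B] par parB rg by auto
  have qB: "q B = A + J" using qe[of B] parB J by auto
  have le: "q R \<le> A + 2 - b" using eq comp qB w' B b by auto
  \<comment> \<open>\<open>Z\<close> is the place on the final stretch, where
    \<open>q m = m + J - (B - A)\<close>, at which \<open>q\<close> equals \<open>A + 2 - b\<close>,
    the bound that \<open>le\<close> puts on \<open>q R\<close>.\<close>
  define Z where "Z = B - J + 2 - b"
  have Z: "even (Z - J)" "even (Z + 2 - J)" using parB parJ by (auto simp: Z_def)
  have qZ: "q Z = A + 2 - b" using qe[of Z] Z J b by (auto simp: Z_def)
  show R1: "n + 2 - q n \<le> B - J + 2 - b"
  proof (rule ccontr)
    assume "\<not> ?thesis"
    then have h: "Z < R" by (simp add: Z_def R_def)
    then have "q R = R + J - (B - A)" using qe[of R] par rg J b by (auto simp: Z_def)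
    then show False using h le by (auto simp: Z_def)
  qed
  assume P: "q n - J + 1 = B" and up: "q (n + 2) = q n + 2"
  have qR: "q R = A + 2 - b" using eq P up qB B by (auto simp: P_def)
  show "n + 2 - q n = B - J + 2 - b"
  proof (rule ccontr)
    assume "\<not> ?thesis"
    then have "R < Z" using R1 by (auto simp: R_def Z_def)
    moreover have "R \<noteq> Z - 1" using par Z by auto
    ultimately have "R \<le> Z - 2" by auto
    then have "q R \<le> q (Z - 2)"
      using gen_mono[OF gen, of R "Z - 2"] par rg Z J b by (auto simp: Z_def)
    moreover have "q (Z - 2) = A - b"
      using qe[of "Z - 2"] Z J b by (auto simp: Z_def)
    ultimately show False using qR by simp
  qed
qed

text \<open>Only one pointer moves, so the new increment is the one it has just read:
  \<open>R\<close> moves after a flat step, \<open>P\<close> after a rise. The disjunction in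
  \<open>walk\<close> then concerns either this increment or one inherited by the resting
  pointer.\<close>

lemma walk_step:
  assumes w: "walk J A B n" and n: "B - 1 \<le> n" "even (n - J - 1)" "n + 2 < C"
  shows "walk J A B (n + 2)"
proof -
  note w' = w[unfolded walk_def]
  define P where "P = q n - J + 1"
  define R where "R = n + 2 - q n"
  have par: "even (P - J)" "even (R - J)" using w' n by (auto simp: P_def R_def)
  have rg: "2 \<le> P" "P \<le> B" "3 \<le> R" "R \<le> B"
    using w' J A B b by (auto simp: P_def R_def)
  note sum = walk_sum[OF w n(1,2)]
  note bal = walk_balance[OF w n(1,2)]
  have qn2: "q (n + 2) = q P + q R + sgn_par (J + 1)" using w' by (simp add: P_def R_def)
  have sgn: "sgn_par (n + 4) = sgn_par (J + 1)" using n by (auto simp: sgn_par_def)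
  consider (flat) "q (n + 2) = q n" "q P = q (P - 2)" | (up) "q (n + 2) = q n + 2" "q R = q (R - 2) + 2"
    using w' by (auto simp: P_def R_def algebra_simps)
  then show ?thesis
  proof cases
    case flat
    have RB: "R + 2 \<le> B" using bal(1) J_b by (simp add: R_def)
    have P': "q (n + 2) - J + 1 = P" "n + 4 - q (n + 2) = R + 2"
      using flat by (auto simp: P_def R_def)
    have 1: "q (n + 3) = n + 4 - (P)" "q (n + 2) = n + 4 - (R + 2)"
      using sum P' by auto
    have rec: "q (n + 4) = q (P) + q (R + 2) + sgn_par (J + 1)"
      unfolding sgn[symmetric]
      by (rule q_recI[OF _ 1]) (use rg RB n J A B b in auto)
    have st: "q (R + 2) = q R \<or> q (R + 2) = q R + 2"
      by (rule gen_step[OF gen]) (use par RB w' J A B b in \<open>auto simp: R_def\<close>)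
    show ?thesis
      unfolding walk_def
      using rec st sum P' flat qn2 w' RB
      by (auto simp: P_def R_def algebra_simps)
  next
    case up
    \<comment> \<open>With \<open>P = B\<close> the balance lemma would fix \<open>R\<close> and
      give \<open>n + 2 = C\<close>.\<close>
    have PB: "P + 2 \<le> B"
    proof (rule ccontr)
      assume "\<not> ?thesis"
      moreover have "P \<noteq> B - 1" using par parB by auto
      ultimately have "P = B" using w' by (auto simp: P_def)
      then show False using bal(2) up n C by (auto simp: P_def)
    qed
    have P': "q (n + 2) - J + 1 = P + 2" "n + 4 - q (n + 2) = R"
      using up by (auto simp: P_def R_def)
    have 1: "q (n + 3) = n + 4 - (P + 2)" "q (n + 2) = n + 4 - (R)"
      using sum P' by auto
    have rec: "q (n + 4) = q (P + 2) + q (R) + sgn_par (J + 1)"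
      unfolding sgn[symmetric]
      by (rule q_recI[OF _ 1]) (use rg PB n J A B b in auto)
    have st: "q (P + 2) = q P \<or> q (P + 2) = q P + 2"
      by (rule gen_step[OF gen]) (use par PB w' J A B b in \<open>auto simp: P_def\<close>)
    show ?thesis
      unfolding walk_def
      using rec st sum P' up qn2 w' PB
      by (auto simp: P_def R_def algebra_simps)
  qed
qed

lemma walk_all:
  assumes "B - 1 \<le> n" "n < C" "even (n - J - 1)"
  shows "walk J A B n"
proof -
  have "walk J A B (B - 1 + 2 * int i)" if "B - 1 + 2 * int i < C" for i
    using that
  proof (induction i)
    case 0
    then show ?case using walk_start by simp
  next
    case (Suc i)
    have "walk J A B (B - 1 + 2 * int i + 2)"
      by (rule walk_step) (use Suc parB in auto)
    then show ?case by (simp add: algebra_simps)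
  qed
  moreover have "even (n - (B - 1))" using assms(3) parB by presburger
  then obtain i where "n = B - 1 + 2 * int i"
    using even_diff_obtains_nat assms(1) by blast
  ultimately show ?thesis using assms(2) by blast
qed

section \<open>End of the walk and the next generation\<close>

lemma gen_end_value:
  assumes "even (m - J)" "B - 2 * J \<le> m" "m \<le> B"
  shows "q m = m + J - (B - A)"
  using gen_sum[OF gen, of m] gen_end[OF gen, of m] assms J A B b by auto

lemma parC: "odd (C - J)"
  using parJ C by auto

text \<open>The bounds \<open>P \<le> B\<close> and \<open>R \<le> B - J + 2 - b\<close> meet at
  \<open>n = C - 2\<close>, so \<open>P\<close> stands exactly at \<open>B\<close>.\<close>

lemma before_top: "q (C - 2) = B + J - 1"
proof -
  have n: "B - 1 \<le> C - 2" "C - 2 < C" "even (C - 2 - J - 1)"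
    using parC C J A B b by auto
  have w: "walk J A B (C - 2)" using walk_all n by blast
  show ?thesis
    using w[unfolded walk_def] walk_balance(1)[OF w n(1,3)] C by auto
qed

text \<open>Going backwards from \<open>C - 2\<close>, \<open>P\<close> descends the final stretch
  of generation \<open>J\<close>. There \<open>q\<close> rises by 2 at every step of its parity,
  whereas a flat step would need \<open>q P = q (P - 2)\<close>.\<close>

lemma top_values:
  assumes "int i \<le> J"
  shows "q (C - 2 * int i - 2) = B + J - 1 - 2 * int i"
  using assms
proof (induction i)
  case 0
  then show ?case using before_top by simp
next
  case (Suc i)
  define n where "n = C - 2 * int i - 4"
  have n: "B - 1 \<le> n" "n < C" "even (n - J - 1)"
    using parC C J A B b Suc.prems by (auto simp: n_def)
  note w = walk_all[OF n, unfolded walk_def]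
  have IH: "q (n + 2) = B + J - 1 - 2 * int i"
    using Suc by (simp add: n_def algebra_simps)
  define m where "m = B - 2 * int i - 2"
  have m: "q m = m + J - (B - A)" "q (m + 2) = m + 2 + J - (B - A)"
    by (rule gen_end_value; use parB Suc.prems in \<open>auto simp: m_def\<close>)+
  have "q (n + 2) \<noteq> q n"
  proof
    assume "q (n + 2) = q n"
    moreover from this have "q n - J + 1 = m + 2" "q n - J - 1 = m"
      using IH by (auto simp: m_def)
    moreover have "q (q n - J + 1) = q (q n - J - 1)"
      using w \<open>q (n + 2) = q n\<close> by linarith
    ultimately have "q (m + 2) = q m"
      by metis
    then show False using m by simp
  qed
  then have "q (n + 2) = q n + 2" using w by auto
  then show ?case using IH by (simp add: n_def algebra_simps)
qed

lemma top_value: "q C = B + J + 1"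
proof -
  have n: "B - 1 \<le> C - 2" "C - 2 < C" "even (C - 2 - J - 1)"
    using parC C J A B b by auto
  note w = walk_all[OF n, unfolded walk_def]
  have m: "q B = A + J" "q (B - 2) = A + J - 2"
    using gen_end_value[of B] gen_end_value[of "B - 2"] parB J by auto
  show ?thesis using w before_top m by auto
qed

lemma next_sum:
  assumes n: "B - 1 \<le> n" "n \<le> C" "even (n - J - 1)"
  shows "q n + q (n + 1) = n + J + 1"
proof (cases "n = B - 1")
  case True
  then show ?thesis using walk_start by (simp add: walk_def)
next
  case False
  have "n \<noteq> B" using n parB by auto
  with False have n': "B - 1 \<le> n - 2" "n - 2 < C" "even (n - 2 - J - 1)" using n by auto
  have "n - 2 + 2 = n" "n - 2 + 3 = n + 1" "n - 2 + J + 3 = n + J + 1" by simp_all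
  then show ?thesis using walk_sum[OF walk_all[OF n'] n'(1,3)] by presburger
qed

text \<open>The constant end of generation \<open>J\<close>, read on the opposite parity, is the
  opening stretch of generation \<open>J + 1\<close>.\<close>

lemma next_initial:
  assumes "B - 2 * J + 1 \<le> n" "n \<le> B + 1" "even (n - J - 1)"
  shows "q n = B - A"
  using gen_end[OF gen, of "n - 1"] assms by (simp add: algebra_simps)

lemma next_gen: "gen (J + 1) B C"
  unfolding gen_def
proof (intro conjI allI impI; (elim conjE)?)
  fix n assume n: "even (n - (J + 1))" "B - 2 * (J + 1) + 3 \<le> n" "n \<le> C"
  have par: "even (n - J - 1)" using n(1) by (simp add: algebra_simps)
  show "q n + q (n + 1) = n + (J + 1)"
  proof (cases "B - 1 \<le> n")
    case True
    then show ?thesis using next_sum[of n] n par by simp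
  next
    case False
    then show ?thesis
      using next_initial[of n] gen_end_value[of "n + 1"] n par by simp
  qed
  show "odd (q n)"
  proof (cases "B - 1 \<le> n \<and> n < C")
    case True
    then show ?thesis using walk_all[of n] par by (auto simp: walk_def)
  next
    case False
    then consider "n = C" | "n < B - 1" using n by force
    then show ?thesis
      using next_initial[of n] n par parA parB top_value by cases auto
  qed
next
  fix n assume n: "even (n - (J + 1))" "B - 2 * (J + 1) + 3 \<le> n" "n + 2 \<le> C"
  then show "q (n + 2) = q n \<or> q (n + 2) = q n + 2"
    using next_initial[of n] next_initial[of "n + 2"] walk_all[of n]
    by (cases "B - 1 \<le> n") (auto simp: walk_def algebra_simps)
next
  fix n assume n: "even (n - (J + 1))" "B - 2 * (J + 1) + 3 \<le> n" "n \<le> B - 1"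
  then show "q (n + 2) = q n"
    using next_initial[of n] next_initial[of "n + 2"] by (auto simp: algebra_simps)
next
  fix n assume n: "even (n - (J + 1))" "C - 2 * (J + 1) \<le> n" "n \<le> C"
  have par: "even (n - J - 1)" using n(1) by (simp add: algebra_simps)
  have "q n = n + B + J + 1 - C"
  proof (cases "n = C")
    case True
    then show ?thesis using top_value by simp
  next
    case False
    have "even (C - n)" using par parC by auto
    then obtain k where k: "C - n = 2 * k" by (rule evenE)
    define i where "i = nat (k - 1)"
    have "n = C - 2 * int i - 2" "int i \<le> J" using k n False by (auto simp: i_def)
    then show ?thesis using top_values[of i] by simp
  qed
  moreover have "q n + q (n + 1) = n + J + 1"
    by (rule next_sum) (use n par C J A B b in auto)
  ultimately show "q (n + 1) = C - B" by simp
qed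

section \<open>Inheritance of the elliptic bound\<close>

text \<open>Adding the bounds at \<open>P\<close> and \<open>R\<close> leaves a surplus
  \<open>36 * d\<^sup>2\<close>, which is at least \<open>y\<^sup>2\<close> unless \<open>y\<close>
  is small; this pays for the step from \<open>J\<close> to \<open>J + 1\<close>. The opening
  stretch and small \<open>y\<close> are left to the assumption \<open>small\<close>.\<close>

lemma next_dev_bound:
  assumes bound: "\<And>n. even (n - J) \<Longrightarrow> A - 2 * J + 3 \<le> n \<Longrightarrow> n \<le> B \<Longrightarrow>
      J * (dev J n)\<^sup>2 \<le> 36 * (X\<^sup>2 - (n + J - X)\<^sup>2)"
    and small: "\<And>e n. B - 2 * J + 1 \<le> n \<Longrightarrow> n \<le> C \<Longrightarrow> \<bar>e\<bar> \<le> 3 * (J + 1) + 12 \<Longrightarrow>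
      (J + 1) * e\<^sup>2 \<le> 36 * ((2 * X)\<^sup>2 - (n + (J + 1) - 2 * X)\<^sup>2)"
    and n: "even (n - (J + 1))" "B - 2 * (J + 1) + 3 \<le> n" "n \<le> C"
  shows "(J + 1) * (dev (J + 1) n)\<^sup>2 \<le> 36 * ((2 * X)\<^sup>2 - (n + (J + 1) - 2 * X)\<^sup>2)"
proof (cases "n \<le> B + 1")
  case True
  have "q n = B - A"
    by (rule next_initial) (use n True in auto)
  then have "\<bar>dev (J + 1) n\<bar> \<le> 3 * (J + 1) + 12"
    using n True b B sgn_J by (auto simp: dev_def)
  then show ?thesis using small n by simp
next
  case False
  define m where "m = n - 2"
  have m: "B - 1 \<le> m" "m < C" "even (m - J - 1)" using False n by (auto simp: m_def)
  have nm: "n = m + 2" by (simp add: m_def)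
  note w = walk_all[OF m, unfolded walk_def]
  define P where "P = q m - J + 1"
  define R where "R = m + 2 - q m"
  define y where "y = dev (J + 1) n"
  define r where "r = n + (J + 1) - 2 * X"
  define d where "d = P - R"
  have par: "even (P - J)" "even (R - J)" using w m by (auto simp: P_def R_def)
  have qn: "q n = q P + q R + sgn_par (J + 1)" using w by (simp add: P_def R_def nm)
  \<comment> \<open>The offset \<open>2 * sgn_par J\<close> in \<open>dev\<close> makes the
    additivity exact despite the perturbation.\<close>
  have y: "y = dev J P + dev J R"
    using sgn_J by (simp add: y_def dev_def qn) (simp add: P_def R_def nm)
  \<comment> \<open>\<open>3 * d\<close> is \<open>6 * q m - 3 * (m + J + 1)\<close>, so it differs
    from \<open>y\<close> only by one increment of \<open>q\<close> and constants.\<close>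
  have near: "\<bar>y - 3 * d\<bar> \<le> 8"
    using w sgn_J b by (auto simp: y_def dev_def d_def P_def R_def nm)
  show ?thesis
  \<comment> \<open>Beyond 16, twice the error 8 in \<open>near\<close>, \<open>3 * d\<close> has at
    least half the size of \<open>y\<close>.\<close>
  proof (cases "\<bar>y\<bar> \<le> 16")
    case True
    then show ?thesis using small[of n y] n J by (simp add: y_def)
  next
    case False
    then have "\<bar>y\<bar> \<le> \<bar>6 * d\<bar>" using near by linarith
    then have yd: "y\<^sup>2 \<le> (6 * d)\<^sup>2" by (simp add: abs_le_square_iff)
    have bP: "J * (dev J P)\<^sup>2 \<le> 36 * (X\<^sup>2 - (P + J - X)\<^sup>2)"
      by (rule bound) (use par w J A B b in \<open>auto simp: P_def\<close>)
    have bR: "J * (dev J R)\<^sup>2 \<le> 36 * (X\<^sup>2 - (R + J - X)\<^sup>2)"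
      by (rule bound) (use par w J A B b in \<open>auto simp: R_def\<close>)
    have "y\<^sup>2 \<le> 2 * ((dev J P)\<^sup>2 + (dev J R)\<^sup>2)"
      unfolding y by (rule power2_sum_le)
    then have "J * y\<^sup>2 \<le> 2 * (J * (dev J P)\<^sup>2 + J * (dev J R)\<^sup>2)"
      using J mult_left_mono[of "y\<^sup>2" "2 * ((dev J P)\<^sup>2 + (dev J R)\<^sup>2)" J] by (simp add: algebra_simps)
    also have "\<dots> \<le> 72 * (2 * X\<^sup>2 - ((P + J - X)\<^sup>2 + (R + J - X)\<^sup>2))"
    proof -
      have "2 * (u + v) \<le> 72 * (2 * x - (a + c))" if "u \<le> 36 * (x - a)" "v \<le> 36 * (x - c)" for u v x a c :: int
        using that by (simp add: algebra_simps)
      then show ?thesis using bP bR by blast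
    qed
    also have "\<dots> = 36 * ((2 * X)\<^sup>2 - (r\<^sup>2 + d\<^sup>2))"
    proof -
      have "r = (P + J - X) + (R + J - X)" "d = (P + J - X) - (R + J - X)"
        by (auto simp: r_def d_def P_def R_def nm)
      then have "r\<^sup>2 + d\<^sup>2 = 2 * ((P + J - X)\<^sup>2 + (R + J - X)\<^sup>2)"
        by (simp only:) (simp add: power2_eq_square algebra_simps)
      then show ?thesis by (simp add: power_mult_distrib)
    qed
    finally have "J * y\<^sup>2 + y\<^sup>2 \<le> 36 * ((2 * X)\<^sup>2 - r\<^sup>2)"
      using yd by (simp add: power_mult_distrib)
    then show ?thesis by (simp add: y_def r_def algebra_simps)
  qed
qed

end

section \<open>End points, initial values and the induction over generations\<close>

fun M :: "nat \<Rightarrow> int" where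
  "M 0 = 2"
| "M (Suc j) = 2 * M j + (if even j then 1 else 0)"

lemma M_closed: "3 * M j = 8 * 2 ^ j - (if even j then 2 else 1)"
  by (induction j) auto

lemma parity_M: "even (M j - int j)"
  by (induction j) auto

lemma M_add_3: "M (k + 3) = 2 * M (k + 2) + (if even k then 1 else 0)"
proof -
  have "k + 3 = Suc (k + 2)" by simp
  then show ?thesis by (simp only: M.simps) simp
qed

lemma M_add_4: "M (k + 4) = 2 * M (k + 3) + (if even k then 0 else 1)"
proof -
  have "k + 4 = Suc (k + 3)" by simp
  then show ?thesis by (simp only: M.simps) simp
qed

lemma M_ge: "2 * int k + 6 \<le> M (k + 2)"
  by (induction k) (auto simp: numeral_2_eq_2)

text \<open>Generation 3, the base case, ends at 21, and its complement identity looks one index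
  further.\<close>

lemma q_initial:
  shows q1: "q 1 = 1"
    and q2: "q 2 = 1"
    and q3: "q 3 = 1"
    and q4: "q 4 = 3"
    and q5: "q 5 = 3"
    and q6: "q 6 = 3"
    and q7: "q 7 = 5"
    and q8: "q 8 = 5"
    and q9: "q 9 = 5"
    and q10: "q 10 = 7"
    and q11: "q 11 = 5"
    and q12: "q 12 = 9"
    and q13: "q 13 = 7"
    and q14: "q 14 = 9"
    and q15: "q 15 = 7"
    and q16: "q 16 = 11"
    and q17: "q 17 = 9"
    and q18: "q 18 = 11"
    and q19: "q 19 = 11"
    and q20: "q 20 = 11"
    and q21: "q 21 = 13"
    and q22: "q 22 = 11"
proof -
  show q1: "q 1 = 1" and q2: "q 2 = 1"
    using Qt_1 Qt_2 by (simp_all add: q_def)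
  show q3: "q 3 = 1"
    using q_rec[of 3] by (simp add: sgn_par_def q1 q2)
  show q4: "q 4 = 3"
    using q_rec[of 4] by (simp add: sgn_par_def q2 q3)
  show q5: "q 5 = 3"
    using q_rec[of 5] by (simp add: sgn_par_def q2 q3 q4)
  show q6: "q 6 = 3"
    using q_rec[of 6] by (simp add: sgn_par_def q3 q4 q5)
  show q7: "q 7 = 5"
    using q_rec[of 7] by (simp add: sgn_par_def q4 q5 q6)
  show q8: "q 8 = 5"
    using q_rec[of 8] by (simp add: sgn_par_def q3 q5 q6 q7)
  show q9: "q 9 = 5"
    using q_rec[of 9] by (simp add: sgn_par_def q4 q7 q8)
  show q10: "q 10 = 7"
    using q_rec[of 10] by (simp add: sgn_par_def q5 q8 q9)
  show q11: "q 11 = 5"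
    using q_rec[of 11] by (simp add: sgn_par_def q4 q6 q9 q10)
  show q12: "q 12 = 9"
    using q_rec[of 12] by (simp add: sgn_par_def q5 q7 q10 q11)
  show q13: "q 13 = 7"
    using q_rec[of 13] by (simp add: sgn_par_def q4 q8 q11 q12)
  show q14: "q 14 = 9"
    using q_rec[of 14] by (simp add: sgn_par_def q5 q7 q12 q13)
  show q15: "q 15 = 7"
    using q_rec[of 15] by (simp add: sgn_par_def q6 q8 q13 q14)
  show q16: "q 16 = 11"
    using q_rec[of 16] by (simp add: sgn_par_def q7 q9 q14 q15)
  show q17: "q 17 = 9"
    using q_rec[of 17] by (simp add: sgn_par_def q6 q10 q15 q16)
  show q18: "q 18 = 11"
    using q_rec[of 18] by (simp add: sgn_par_def q7 q9 q16 q17)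
  show q19: "q 19 = 11"
    using q_rec[of 19] by (simp add: sgn_par_def q8 q10 q17 q18)
  show q20: "q 20 = 11"
    using q_rec[of 20] by (simp add: sgn_par_def q9 q18 q19)
  show q21: "q 21 = 13"
    using q_rec[of 21] by (simp add: sgn_par_def q10 q19 q20)
  show q22: "q 22 = 11"
    using q_rec[of 22] by (simp add: sgn_par_def q9 q11 q20 q21)
qed

lemma gen_3: "gen 3 10 21"
proof -
  have 1: "n \<in> {7, 9, 11, 13, 15, 17, 19, 21}" if "even (n - 3)" "7 \<le> n" "n \<le> 21" for n :: int
    using that by simp presburger
  show ?thesis
    unfolding gen_def
  proof (intro conjI allI impI; (elim conjE)?)
    fix n :: int assume "even (n - 3)" "10 - 2 * 3 + 3 \<le> n" "n \<le> 21"
    then show "q n + q (n + 1) = n + 3" "odd (q n)"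
      using 1[of n] by (auto simp: q_initial)
  next
    fix n :: int assume "even (n - 3)" "10 - 2 * 3 + 3 \<le> n" "n + 2 \<le> 21"
    then show "q (n + 2) = q n \<or> q (n + 2) = q n + 2"
      using 1[of n] by (auto simp: q_initial)
  next
    fix n :: int assume "even (n - 3)" "10 - 2 * 3 + 3 \<le> n" "n \<le> 10 - 1"
    then show "q (n + 2) = q n"
      using 1[of n] by (auto simp: q_initial)
  next
    fix n :: int assume "even (n - 3)" "21 - 2 * 3 \<le> n" "n \<le> 21"
    then show "q (n + 1) = 21 - 10"
      using 1[of n] by (auto simp: q_initial)
  qed
qed

lemma generation_M:
  assumes "gen (int k + 3) (M (k + 2)) (M (k + 3))"
  shows "generation (int k + 3) (M (k + 2)) (M (k + 3)) (M (k + 4)) (if even k then 1 else 0)"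
proof
  show "2 * (int k + 3) \<le> M (k + 2)" using M_ge[of k] by simp
  show "odd (M (k + 2) - (int k + 3))" using parity_M[of "k + 2"] by simp
qed (use assms in \<open>auto simp: M_add_3 M_add_4\<close>)

lemma gen_all: "gen (int k + 3) (M (k + 2)) (M (k + 3))"
proof (induction k)
  case 0
  then show ?case using gen_3 by (simp add: eval_nat_numeral)
next
  case (Suc k)
  then interpret generation "int k + 3" "M (k + 2)" "M (k + 3)" "M (k + 4)" "if even k then 1 else 0"
    by (rule generation_M)
  show ?case using next_gen by (simp add: eval_nat_numeral algebra_simps)
qed

section \<open>The elliptic bound in all generations\<close>

text \<open>With \<open>J = k + 3\<close> this is \<open>J * (J + 4)\<^sup>2 \<le> X\<^sup>2\<close>
  for \<open>X = 2 ^ (J + 1)\<close>, so deviations up to \<open>3 * (J + 4)\<close> are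
  negligible.\<close>

lemma cubic_le_power4: "(int k + 3) * (int k + 7)\<^sup>2 \<le> 4 * 4 ^ (k + 3)"
proof (induction k)
  case (Suc k)
  have "(int (Suc k) + 3) * (int (Suc k) + 7)\<^sup>2 \<le> 4 * ((int k + 3) * (int k + 7)\<^sup>2)"
    by (simp add: power2_eq_square algebra_simps)
  also have "\<dots> \<le> 4 * (4 * 4 ^ (k + 3))" using Suc by simp
  also have "\<dots> = 4 * 4 ^ (Suc k + 3)" by (simp add: power_add)
  finally show ?case .
qed auto

text \<open>
  The elliptic bound is trivial for deviations of logarithmic size: \<open>\<bar>r\<bar>\<close> stays below five sixths
  of the half axis.
\<close>

lemma small_dev:
  fixes n e :: int
  assumes "M (k + 2) - 2 * (int k + 3) + 3 \<le> n" "n \<le> M (k + 3)"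
    and e: "\<bar>e\<bar> \<le> 3 * (int k + 3) + 12"
  shows "(int k + 3) * e\<^sup>2 \<le> 36 * ((2 ^ (k + 4))\<^sup>2 - (n + (int k + 3) - 2 ^ (k + 4))\<^sup>2)"
proof -
  define X :: int where "X = 2 ^ (k + 4)"
  define r where "r = n + (int k + 3) - X"
  have M: "3 * M (k + 2) \<ge> 2 * X - 2" "3 * M (k + 3) \<le> 4 * X"
    unfolding M_closed by (auto simp: X_def power_add)
  have "int k < 2 ^ k" by (rule of_nat_less_two_power)
  moreover have "X = 16 * 2 ^ k" by (simp add: X_def power_add)
  moreover have "(1::int) \<le> 2 ^ k" by simp
  ultimately have "2 * int k + 6 \<le> X" by linarith
  \<comment> \<open>\<open>\<bar>r\<bar>\<close> is at most \<open>X / 3 + J\<close>, and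
    \<open>J \<le> X / 2\<close>.\<close>
  then have "\<bar>6 * r\<bar> \<le> \<bar>5 * X\<bar>" using M assms(1,2) by (auto simp: r_def)
  then have "(6 * r)\<^sup>2 \<le> (5 * X)\<^sup>2" by (simp add: abs_le_square_iff)
  then have r: "36 * (X\<^sup>2 - r\<^sup>2) \<ge> 11 * X\<^sup>2" by (simp add: power_mult_distrib)
  have X2: "X\<^sup>2 = 4 * 4 ^ (k + 3)"
    by (simp add: X_def power_add power2_eq_square flip: power_mult_distrib)
  have "e\<^sup>2 \<le> (3 * (int k + 7))\<^sup>2"
    using e by (intro abs_le_square_iff[THEN iffD1]) auto
  then have "(int k + 3) * e\<^sup>2 \<le> (int k + 3) * (3 * (int k + 7))\<^sup>2"
    by (intro mult_left_mono) auto
  also have "\<dots> = 9 * ((int k + 3) * (int k + 7)\<^sup>2)"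
    by (simp only: power_mult_distrib) simp
  also have "\<dots> \<le> 9 * X\<^sup>2"
    using cubic_le_power4[of k] X2 by simp
  also have "\<dots> \<le> 36 * (X\<^sup>2 - r\<^sup>2)" using r zero_le_power2[of X] by linarith
  finally show ?thesis by (simp add: X_def r_def)
qed

lemma dev_bound:
  assumes "even (n - (int k + 3))" "M (k + 2) - 2 * (int k + 3) + 3 \<le> n" "n \<le> M (k + 3)"
  shows "(int k + 3) * (dev (int k + 3) n)\<^sup>2 \<le> 36 * ((2 ^ (k + 4))\<^sup>2 - (n + (int k + 3) - 2 ^ (k + 4))\<^sup>2)"
  using assms
proof (induction k arbitrary: n)
  case 0
  have "n \<in> {7, 9, 11, 13, 15, 17, 19, 21}"
    using 0 by (simp add: eval_nat_numeral) presburger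
  \<comment> \<open>The value 21 is \<open>3 * 3 + 12\<close>, the threshold of
    \<open>small_dev\<close> for generation 3.\<close>
  then have "\<bar>dev 3 n\<bar> \<le> 21"
    by (auto simp: dev_def sgn_par_def q_initial)
  then show ?case using small_dev[of 0 n "dev 3 n"] 0 by simp
next
  case (Suc k)
  interpret generation "int k + 3" "M (k + 2)" "M (k + 3)" "M (k + 4)" "if even k then 1 else 0"
    by (rule generation_M[OF gen_all])
  have idx: "Suc k + 2 = k + 3" "Suc k + 3 = k + 4" "int (Suc k) + 3 = int k + 3 + 1"
      "(2::int) ^ (Suc k + 4) = 2 * 2 ^ (k + 4)" by (simp_all add: power_add)
  show ?case
    unfolding idx
  proof (rule next_dev_bound)
    fix e m assume "M (k + 3) - 2 * (int k + 3) + 1 \<le> m" "m \<le> M (k + 4)"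
      "\<bar>e\<bar> \<le> 3 * (int k + 3 + 1) + 12"
    then show "(int k + 3 + 1) * e\<^sup>2 \<le> 36 * ((2 * 2 ^ (k + 4))\<^sup>2 - (m + (int k + 3 + 1) - 2 * 2 ^ (k + 4))\<^sup>2)"
      using small_dev[of "Suc k" m e] unfolding idx by simp
  qed (use Suc in \<open>simp_all only: idx\<close>)
qed

section \<open>From generations to the asymptotic bound\<close>

lemma M_interval:
  assumes "21 < N"
  obtains k where "M (k + 3) < N" "N \<le> M (k + 4)"
proof -
  have "\<exists>k. M (k + 3) < N \<and> N \<le> M (k + 4)" if "N \<le> M (i + 3)" for i
    using that
  proof (induction i)
    case 0
    then show ?case using assms by (simp add: eval_nat_numeral)
  next
    case (Suc i)
    then show ?case by (cases "N \<le> M (i + 3)") (auto intro!: exI[of _ i] simp: eval_nat_numeral)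
  qed
  moreover have "N \<le> M (nat N + 3)"
    using M_ge[of "nat N + 1"] assms by (simp add: numeral_3_eq_3 del: M.simps)
  ultimately show ?thesis using that by blast
qed

lemma q_near_half:
  assumes "M (k + 3) < N" "N \<le> M (k + 4)"
  shows "(int k + 4) * (6 * q N - 3 * N)\<^sup>2 \<le> 144 * (2 ^ (k + 5))\<^sup>2"
proof -
  define J where "J = int k + 4"
  define n where "n = (if even (N - J) then N else N - 1)"
  have n: "even (n - J)" "M (k + 3) \<le> n" "n \<le> M (k + 4)" using assms by (auto simp: n_def)
  have idx: "k + 1 + 2 = k + 3" "k + 1 + 3 = k + 4" "k + 1 + 4 = k + 5" "int (k + 1) + 3 = J"
    by (auto simp: J_def)
  have g: "gen J (M (k + 3)) (M (k + 4))"
    using gen_all[of "k + 1"] unfolding idx .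
  have low: "M (k + 3) - 2 * J + 3 \<le> n" using n by (simp add: J_def)
  define X :: int where "X = 2 ^ (k + 5)"
  \<comment> \<open>\<open>u\<close> absorbs the terms of order \<open>J\<close> that separate
    \<open>6 * q N - 3 * N\<close> from \<open>dev J n\<close> up to sign, and is the largest size
    that \<open>small_dev\<close> admits.\<close>
  define u where "u = 3 * J + 12"
  have "J * (dev J n)\<^sup>2 \<le> 36 * (X\<^sup>2 - (n + J - X)\<^sup>2)"
    using dev_bound[of n "k + 1"] n low unfolding idx X_def by simp
  also have "\<dots> \<le> 36 * X\<^sup>2" by simp
  finally have 1: "J * (dev J n)\<^sup>2 \<le> 36 * X\<^sup>2" .
  have "J * u\<^sup>2 \<le> 36 * (X\<^sup>2 - (n + J - X)\<^sup>2)"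
    using small_dev[of "k + 1" n u] n low unfolding idx X_def by (simp add: u_def J_def)
  also have "\<dots> \<le> 36 * X\<^sup>2" by simp
  finally have 2: "J * u\<^sup>2 \<le> 36 * X\<^sup>2" .
  have s: "sgn_par J = 1 \<or> sgn_par J = - 1" by (simp add: sgn_par_def)
  have "\<bar>6 * q N - 3 * N\<bar> \<le> \<bar>dev J n\<bar> + u"
  proof (cases "even (N - J)")
    case True
    then have "N = n" by (simp add: n_def)
    then show ?thesis using s by (auto simp: dev_def u_def J_def)
  next
    case False
    then have "N = n + 1" by (simp add: n_def)
    moreover have "q (n + 1) = n + J - q n"
      by (rule gen_sum[OF g n(1) low n(3)])
    ultimately show ?thesis using s by (auto simp: dev_def u_def J_def)
  qed
  then have "\<bar>6 * q N - 3 * N\<bar>\<^sup>2 \<le> (\<bar>dev J n\<bar> + u)\<^sup>2"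
    by (rule power_mono) auto
  also have "\<dots> \<le> 2 * ((dev J n)\<^sup>2 + u\<^sup>2)"
    using power2_sum_le[of "\<bar>dev J n\<bar>" u] by simp
  finally have "J * (6 * q N - 3 * N)\<^sup>2 \<le> J * (2 * ((dev J n)\<^sup>2 + u\<^sup>2))"
    by (intro mult_left_mono) (auto simp: J_def)
  also have "\<dots> = 2 * (J * (dev J n)\<^sup>2) + 2 * (J * u\<^sup>2)" by (simp add: algebra_simps)
  also have "\<dots> \<le> 144 * X\<^sup>2" using 1 2 by linarith
  finally show ?thesis by (simp add: J_def X_def)
qed

lemma Qt_ratio_bound:
  assumes "21 < N"
  shows "\<bar>real_of_int (Qt N) / real N - 1 / 2\<bar> \<le> 6 * (1 / sqrt (ln (real N)))"
proof -
  obtain k where k: "M (k + 3) < int N" "int N \<le> M (k + 4)"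
    using M_interval[of "int N"] assms by auto
  define X :: real where "X = 2 ^ (k + 5)"
  define J where "J = real k + 4"
  define t where "t = real_of_int (Qt N) / real N - 1 / 2"
  have N0: "real N > 0" using assms by simp
  have X1: "X \<ge> 32" by (simp add: X_def power_add)
  have M3: "3 * real_of_int (M (k + 3)) \<ge> 2 * X - 2" "3 * real_of_int (M (k + 4)) \<le> 4 * X"
    using arg_cong[OF M_closed[of "k + 3"], of real_of_int] arg_cong[OF M_closed[of "k + 4"], of real_of_int]
    by (auto simp: X_def power_add split: if_splits)
  have NX: "X \<le> 2 * real N" using k(1) M3(1) X1 by linarith
  have NX': "real N \<le> 2 * X" using k(2) M3(2) X1 by linarith
  have "real_of_int ((int k + 4) * (6 * q (int N) - 3 * int N)\<^sup>2) \<le> real_of_int (144 * (2 ^ (k + 5))\<^sup>2)"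
    using q_near_half[OF k] by (simp only: of_int_le_iff)
  then have "J * (6 * real_of_int (Qt N) - 3 * real N)\<^sup>2 \<le> 144 * X\<^sup>2"
    by (simp add: J_def X_def q_def)
  moreover have "6 * real_of_int (Qt N) - 3 * real N = 6 * (t * real N)"
    using N0 by (simp add: t_def field_simps)
  ultimately have "J * (6 * (t * real N))\<^sup>2 \<le> 144 * X\<^sup>2" by simp
  also have "\<dots> \<le> 144 * (2 * real N)\<^sup>2" using NX X1 by (intro mult_left_mono power_mono) auto
  finally have "(J * t\<^sup>2) * (real N)\<^sup>2 \<le> 16 * (real N)\<^sup>2" by (simp add: power_mult_distrib algebra_simps)
  then have Jt: "J * t\<^sup>2 \<le> 16" using N0 by simp
  \<comment> \<open>Since \<open>ln N \<le> 2 * J\<close>, the bound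
    \<open>J * t\<^sup>2 \<le> 16\<close> gives \<open>ln N * t\<^sup>2 \<le> 32\<close>, below
    \<open>6\<^sup>2\<close>.\<close>
  have "ln (real N) \<le> ln (2 ^ (k + 6))"
    using NX' N0 by (subst ln_le_cancel_iff) (auto simp: X_def power_add)
  also have "\<dots> = real (k + 6) * ln 2" by (simp add: ln_realpow)
  also have "\<dots> \<le> real (k + 6) * 1" using ln_2_less_1 by (intro mult_left_mono) auto
  also have "\<dots> \<le> 2 * J" by (simp add: J_def)
  finally have "ln (real N) * t\<^sup>2 \<le> 2 * J * t\<^sup>2" by (intro mult_right_mono) auto
  then have lt: "ln (real N) * t\<^sup>2 \<le> 6\<^sup>2" using Jt by simp
  have ln0: "ln (real N) > 0" using assms by simp
  have "(sqrt (ln (real N)) * \<bar>t\<bar>)\<^sup>2 \<le> 6\<^sup>2" using lt ln0 by (simp add: power_mult_distrib)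
  then have "sqrt (ln (real N)) * \<bar>t\<bar> \<le> 6" by (rule power2_le_imp_le) simp
  then show ?thesis using ln0 by (simp add: t_def field_simps)
qed

theorem theorem1p1:
  shows "(\<lambda>n::nat. \<bar>real_of_int (Qt n) / real n - 1 / 2\<bar>) \<in> O(\<lambda>n. 1 / sqrt (ln (real n)))"
proof (rule bigoI[of _ 6], rule eventually_mono[OF eventually_gt_at_top[of 21]])
  fix n :: nat assume n: "21 < n"
  then have "ln (real n) \<ge> 0" by simp
  then show "norm \<bar>real_of_int (Qt n) / real n - 1 / 2\<bar> \<le> 6 * norm (1 / sqrt (ln (real n)))"
    using Qt_ratio_bound[OF n] by simp
qed

end
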